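(* For every integer $d\ge 1$, every $d$-dimensional simplex $S\subseteq\mathbb{R}^\infty$ is P-Ramsey.
   Context: $\mathbb{R}^\infty$ denotes the subspace of $\ell^2$ of real sequences with only finitely many nonzero entries, with the Euclidean metric. A configuration is a set of points of $\mathbb{R}^\infty$. A copy of a configuration $B$ is a configuration $B'$ for which there is a distance-preserving bijection $B\to B'$. A configuration $Z$ is $X$-free if no subset of $Z$ is a copy of $X$. For configurations $A,B$ and an integer $r\ge1$, $A\rightarrow(B)_r$ means that every coloring of the points of $A$ with $r$ colors admits a monochromatic subset of $A$ that is a copy of $B$. A $d$-dimensional simplex is a configuration consisting of $d+1$ affinely independent points in $\mathbb{R}^\infty$. A finite configuration $X\subseteq\mathbb{R}^\infty$ is P-Ramsey if there exist a configuration $Y\subseteq\mathbb{R}^\infty$ and a real number $\mu>0$ such that: (i) $Y\rightarrow(X)_r$ for every integer $r\ge1$; (ii) every finite $Y'\subseteq Y$ contains a subset $Z\subseteq Y'$ with $|Z|\ge\mu|Y'|$ such that $Z$ is $X$-free. *)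

theory Defs
  imports "HOL-Analysis.Analysis"
begin

section \<open>The inner product space of finitely supported real sequences\<close>

text \<open>
  The library type of finitely supported maps cannot serve here: as a metric space it carries
  the distance of l1. Hence a separate type, whose metric is that of l2.
\<close>

typedef rinfty = "{x :: nat \<Rightarrow> real. finite {i. x i \<noteq> 0}}"
  morphisms coord Abs_rinfty
  by (rule exI[of _ "\<lambda>_. 0"]) simp

setup_lifting type_definition_rinfty

lemma finite_support: "finite {i. coord x i \<noteq> 0}"
  using coord[of x] by simp

lemma rinfty_eqI: "(\<And>i. coord x i = coord y i) \<Longrightarrow> x = y"
  by (simp add: coord_inject[symmetric] fun_eq_iff)

instantiation rinfty :: real_vector
begin

lift_definition zero_rinfty :: rinfty is "\<lambda>_. 0"
  by simp

lift_definition plus_rinfty :: "rinfty \<Rightarrow> rinfty \<Rightarrow> rinfty" is "\<lambda>x y i. x i + y i"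
proof -
  fix x y :: "nat \<Rightarrow> real"
  assume "finite {i. x i \<noteq> 0}" "finite {i. y i \<noteq> 0}"
  then have "finite ({i. x i \<noteq> 0} \<union> {i. y i \<noteq> 0})"
    by simp
  then show "finite {i. x i + y i \<noteq> 0}"
    by (rule rev_finite_subset) auto
qed

lift_definition uminus_rinfty :: "rinfty \<Rightarrow> rinfty" is "\<lambda>x i. - x i"
  by simp

lift_definition minus_rinfty :: "rinfty \<Rightarrow> rinfty \<Rightarrow> rinfty" is "\<lambda>x y i. x i - y i"
proof -
  fix x y :: "nat \<Rightarrow> real"
  assume "finite {i. x i \<noteq> 0}" "finite {i. y i \<noteq> 0}"
  then have "finite ({i. x i \<noteq> 0} \<union> {i. y i \<noteq> 0})"
    by simp
  then show "finite {i. x i - y i \<noteq> 0}"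
    by (rule rev_finite_subset) auto
qed

lift_definition scaleR_rinfty :: "real \<Rightarrow> rinfty \<Rightarrow> rinfty" is "\<lambda>c x i. c * x i"
  by (erule rev_finite_subset) auto

instance
  by standard (transfer; simp add: fun_eq_iff algebra_simps)+

end

lemma coord_zero [simp]: "coord 0 i = 0"
  by (simp add: zero_rinfty.rep_eq)

lemma coord_add [simp]: "coord (x + y) i = coord x i + coord y i"
  by (simp add: plus_rinfty.rep_eq)

lemma coord_uminus [simp]: "coord (- x) i = - coord x i"
  by (simp add: uminus_rinfty.rep_eq)

lemma coord_diff [simp]: "coord (x - y) i = coord x i - coord y i"
  by (simp add: minus_rinfty.rep_eq)

lemma coord_scaleR [simp]: "coord (c *\<^sub>R x) i = c * coord x i"
  by (simp add: scaleR_rinfty.rep_eq)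

instantiation rinfty :: real_inner
begin

definition inner_rinfty :: "rinfty \<Rightarrow> rinfty \<Rightarrow> real"
  where "inner_rinfty x y = (\<Sum>i | coord x i \<noteq> 0. coord x i * coord y i)"

definition norm_rinfty :: "rinfty \<Rightarrow> real"
  where "norm_rinfty x = sqrt (inner x x)"

definition sgn_rinfty :: "rinfty \<Rightarrow> rinfty"
  where "sgn_rinfty x = x /\<^sub>R norm x"

definition dist_rinfty :: "rinfty \<Rightarrow> rinfty \<Rightarrow> real"
  where "dist_rinfty x y = norm (x - y)"

definition uniformity_rinfty :: "(rinfty \<times> rinfty) filter"
  where "uniformity_rinfty = (INF e\<in>{0<..}. principal {(x, y). dist x y < e})"

definition open_rinfty :: "rinfty set \<Rightarrow> bool"
  where "open_rinfty U \<longleftrightarrow> (\<forall>x\<in>U. eventually (\<lambda>(x', y). x' = x \<longrightarrow> y \<in> U) uniformity)"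

lemma inner_rinfty_superset:
  assumes "finite A" "{i. coord x i \<noteq> 0} \<subseteq> A"
  shows "inner x y = (\<Sum>i\<in>A. coord x i * coord y i)"
  unfolding inner_rinfty_def using assms by (intro sum.mono_neutral_left) auto

instance
proof
  fix x y z :: rinfty and c :: real
  define A where "A = {i. coord x i \<noteq> 0} \<union> {i. coord y i \<noteq> 0}"
  have fin: "finite A"
    unfolding A_def by (intro finite_UnI finite_support)
  have inner_A: "inner u w = (\<Sum>i\<in>A. coord u i * coord w i)"
    if "{i. coord u i \<noteq> 0} \<subseteq> A" for u w
    by (rule inner_rinfty_superset[OF fin that])
  have sub: "{i. coord x i \<noteq> 0} \<subseteq> A" "{i. coord y i \<noteq> 0} \<subseteq> A"
    "{i. coord (x + y) i \<noteq> 0} \<subseteq> A" "{i. coord (c *\<^sub>R x) i \<noteq> 0} \<subseteq> A"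
    by (auto simp: A_def)
  show "inner x y = inner y x"
    by (simp add: inner_A sub mult.commute)
  show "inner (x + y) z = inner x z + inner y z"
    unfolding inner_A[OF sub(1)] inner_A[OF sub(2)] inner_A[OF sub(3)]
    by (simp add: sum.distrib algebra_simps)
  show "inner (c *\<^sub>R x) y = c * inner x y"
    unfolding inner_A[OF sub(1)] inner_A[OF sub(4)]
    by (simp add: sum_distrib_left algebra_simps)
  show "0 \<le> inner x x"
    by (simp add: inner_rinfty_def sum_nonneg)
  show "inner x x = 0 \<longleftrightarrow> x = 0"
  proof
    assume "inner x x = 0"
    then have "\<forall>i\<in>{i. coord x i \<noteq> 0}. coord x i * coord x i = 0"
      unfolding inner_rinfty_def
      by (subst (asm) sum_nonneg_eq_0_iff) (auto intro: finite_support)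
    then show "x = 0"
      by (auto intro!: rinfty_eqI)
  qed (simp add: inner_rinfty_def)
qed (simp_all add: norm_rinfty_def sgn_rinfty_def dist_rinfty_def uniformity_rinfty_def
      open_rinfty_def)

end

lemma dist_rinfty_eq:
  assumes "finite A" "\<And>i. i \<notin> A \<Longrightarrow> coord x i = coord y i"
  shows "dist x y = sqrt (\<Sum>i\<in>A. (coord x i - coord y i)\<^sup>2)"
proof -
  have "{i. coord (x - y) i \<noteq> 0} \<subseteq> A"
    using assms(2) by auto
  from inner_rinfty_superset[OF assms(1) this, of "x - y"] show ?thesis
    by (simp add: dist_norm norm_eq_sqrt_inner power2_eq_square)
qed


section \<open>Configurations\<close>

type_synonym config = "rinfty set"

definition is_copy :: "config \<Rightarrow> config \<Rightarrow> bool"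
  where "is_copy B B' \<longleftrightarrow>
    (\<exists>f. bij_betw f B B' \<and> (\<forall>x\<in>B. \<forall>y\<in>B. dist (f x) (f y) = dist x y))"

definition config_free :: "config \<Rightarrow> config \<Rightarrow> bool"
  where "config_free X Z \<longleftrightarrow> (\<nexists>W. W \<subseteq> Z \<and> is_copy X W)"

definition arrows :: "config \<Rightarrow> config \<Rightarrow> nat \<Rightarrow> bool"
  where "arrows A B r \<longleftrightarrow>
    (\<forall>c :: rinfty \<Rightarrow> nat. c ` A \<subseteq> {..<r} \<longrightarrow>
      (\<exists>W k. W \<subseteq> A \<and> is_copy B W \<and> k < r \<and> (\<forall>x\<in>W. c x = k)))"

text \<open>
  A simplex is here its finite set of vertices, unlike the library's simplex, which is the
  convex hull of that set.
\<close>

definition is_simplex_config :: "nat \<Rightarrow> config \<Rightarrow> bool"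
  where "is_simplex_config d S \<longleftrightarrow> finite S \<and> card S = d + 1 \<and> \<not> affine_dependent S"

definition P_Ramsey :: "config \<Rightarrow> bool"
  where "P_Ramsey X \<longleftrightarrow> finite X \<and>
    (\<exists>(Y :: config) (\<mu> :: real). \<mu> > 0 \<and>
      (\<forall>r\<ge>1. arrows Y X r) \<and>
      (\<forall>Y'. finite Y' \<and> Y' \<subseteq> Y \<longrightarrow>
        (\<exists>Z. Z \<subseteq> Y' \<and> real (card Z) \<ge> \<mu> * real (card Y') \<and> config_free X Z)))"

end

theory Submission
  imports Defs "HOL-Library.Ramsey"
begin

text \<open>
  Fix reals \<open>v\<^sub>1, \<dots>, v\<^sub>k\<close> and let \<open>Y\<close> be the spread of all points \<open>\<Sum>\<^sub>t v\<^sub>t e(i\<^sub>t)\<close> with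
  \<open>i\<^sub>1 < \<dots> < i\<^sub>k\<close>. A colouring of \<open>Y\<close> colours the \<open>k\<close>-subsets of the naturals, so by Ramsey's theorem
  \<open>Y\<close> arrows every configuration that embeds into it. On the other hand, give each coordinate a random
  position in \<open>{1, \<dots>, k}\<close> and keep the points all of whose indices \<open>i\<^sub>t\<close> got position \<open>t\<close>: each point
  survives with probability at least \<open>k\<^sup>-\<^sup>k\<close>, and all squared distances between survivors are of the form
  \<open>2 \<Sum>\<^sub>t\<^sub>\<in>\<^sub>T v\<^sub>t\<^sup>2\<close>. So it suffices to embed the simplex into a spread for which some squared
  distance of the simplex is not of this form.

  Shifts of a long tent-shaped vector realize, up to scaling and a small error, the squared
  distances of points on a line; concatenating vectors adds squared distances, so every Euclidean
  metric is approximated. By affine independence the simplex can be contracted so that all squared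
  distances drop by almost the same small amount; the contracted simplex is approximated by
  tents, and the almost constant remainder is realized exactly by short vectors, one per pair,
  which overlap only for that pair. Two real parameters of the construction, the scale of the
  tents and the size of the short vectors, are chosen outside a finite set of bad values.
\<close>


section \<open>Rows and the metrics they realize\<close>

text \<open>
  A row is a vector of a spread together with its positions: reading the nonblank entries from
  left to right gives the vector. Concatenation of rows then adds squared distances.
\<close>

definition entry :: "real option \<Rightarrow> real"
  where "entry = case_option 0 (\<lambda>x. x)"

text \<open>An entry \<open>Some 0\<close> is kept: a zero of the vector occupies a position, a
  blank does not. Both have the same numerical value.\<close>

definition nonblank :: "real option list \<Rightarrow> real list"
  where "nonblank r = map the (filter (\<lambda>x. x \<noteq> None) r)"

definition row_sqdist :: "real option list \<Rightarrow> real option list \<Rightarrow> real"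
  where "row_sqdist r s = (\<Sum>(x, y)\<leftarrow>zip r s. (entry x - entry y)\<^sup>2)"

text \<open>Columns are abstract: any increasing list of coordinates may later carry them.
  \<open>D\<close> plays the role of a squared distance, since squares add up under
  concatenation.\<close>

definition realizes :: "'a set \<Rightarrow> real list \<Rightarrow> ('a \<Rightarrow> 'a \<Rightarrow> real) \<Rightarrow> bool"
  where "realizes T v D \<longleftrightarrow> (\<exists>N R. (\<forall>a\<in>T. length (R a) = N \<and> nonblank (R a) = v) \<and>
    (\<forall>a\<in>T. \<forall>b\<in>T. row_sqdist (R a) (R b) = D a b))"

lemma entry_simps [simp]: "entry None = 0" "entry (Some x) = x"
  by (simp_all add: entry_def)

lemma realizes_cong:
  assumes "realizes T v D" "\<And>a b. a \<in> T \<Longrightarrow> b \<in> T \<Longrightarrow> D a b = E a b"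
  shows "realizes T v E"
  using assms unfolding realizes_def by metis

lemma realizes_sym:
  assumes "realizes T v D" "a \<in> T" "b \<in> T"
  shows "D a b = D b a"
proof -
  have "row_sqdist r s = row_sqdist s r" if "length r = length s" for r s
    using that by (induction r s rule: list_induct2) (auto simp: row_sqdist_def power2_commute)
  then show ?thesis
    using assms unfolding realizes_def by metis
qed

lemma realizes_self:
  assumes "realizes T v D" "a \<in> T"
  shows "D a a = 0"
proof -
  have "row_sqdist r r = 0" for r
    by (induction r) (auto simp: row_sqdist_def)
  then show ?thesis
    using assms unfolding realizes_def by metis
qed

lemma realizes_Nil: "realizes T [] (\<lambda>_ _. 0)"
  unfolding realizes_def
  by (intro exI[of _ 0] exI[of _ "\<lambda>_. []"]) (simp add: nonblank_def row_sqdist_def)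

lemma realizes_append:
  assumes "realizes T v D" "realizes T w E"
  shows "realizes T (v @ w) (\<lambda>a b. D a b + E a b)"
proof -
  from assms(1) obtain N R where R: "\<And>a. a \<in> T \<Longrightarrow> length (R a) = N \<and> nonblank (R a) = v"
    "\<And>a b. a \<in> T \<Longrightarrow> b \<in> T \<Longrightarrow> row_sqdist (R a) (R b) = D a b"
    unfolding realizes_def by blast
  from assms(2) obtain M Q where Q: "\<And>a. a \<in> T \<Longrightarrow> length (Q a) = M \<and> nonblank (Q a) = w"
    "\<And>a b. a \<in> T \<Longrightarrow> b \<in> T \<Longrightarrow> row_sqdist (Q a) (Q b) = E a b"
    unfolding realizes_def by blast
  have "row_sqdist (R a @ Q a) (R b @ Q b) = D a b + E a b" if "a \<in> T" "b \<in> T" for a b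
    using R[of a] R[of b] Q[of a] Q[of b] R(2)[OF that] Q(2)[OF that] that
    by (simp add: row_sqdist_def)
  then show ?thesis
    unfolding realizes_def using R Q
    by (intro exI[of _ "N + M"] exI[of _ "\<lambda>a. R a @ Q a"]) (auto simp: nonblank_def)
qed

lemma realizes_scale:
  assumes "realizes T v D"
  shows "realizes T (map ((*) c) v) (\<lambda>a b. c\<^sup>2 * D a b)"
proof -
  from assms obtain N R where R: "\<And>a. a \<in> T \<Longrightarrow> length (R a) = N \<and> nonblank (R a) = v"
    "\<And>a b. a \<in> T \<Longrightarrow> b \<in> T \<Longrightarrow> row_sqdist (R a) (R b) = D a b"
    unfolding realizes_def by blast
  let ?m = "map (map_option ((*) c))"
  have nb: "nonblank (?m r) = map ((*) c) (nonblank r)" for r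
    by (induction r) (auto simp: nonblank_def)
  have e: "entry (map_option ((*) c) x) = c * entry x" for x
    by (cases x) auto
  have sq: "row_sqdist (?m r) (?m s) = c\<^sup>2 * row_sqdist r s" for r s
  proof -
    have "row_sqdist (?m r) (?m s) = (\<Sum>p\<leftarrow>zip r s. c\<^sup>2 * (entry (fst p) - entry (snd p))\<^sup>2)"
      by (simp add: row_sqdist_def zip_map_map o_def case_prod_unfold e power_mult_distrib
          flip: right_diff_distrib)
    then show ?thesis
      by (simp add: row_sqdist_def sum_list_const_mult case_prod_unfold)
  qed
  show ?thesis
    unfolding realizes_def using R
    by (intro exI[of _ "N"] exI[of _ "\<lambda>a. ?m (R a)"]) (auto simp: nb sq)
qed

text \<open>Integer arguments let a list shifted to the right read zeros before its start.\<close>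

definition zero_extend :: "real list \<Rightarrow> int \<Rightarrow> real"
  where "zero_extend v t = (if 0 \<le> t \<and> t < int (length v) then v ! nat t else 0)"

text \<open>With \<open>m a\<close> blanks before \<open>v\<close> and \<open>K - m a\<close> blanks
  after it, all rows get the same length.\<close>

lemma realizes_shift:
  fixes m :: "'a \<Rightarrow> nat"
  assumes "\<And>a. a \<in> T \<Longrightarrow> m a \<le> K"
  shows "realizes T v (\<lambda>a b. \<Sum>n<K + length v.
    (zero_extend v (int n - int (m a)) - zero_extend v (int n - int (m b)))\<^sup>2)"
proof -
  define R where "R a = replicate (m a) None @ map Some v @ replicate (K - m a) None" for a
  have len: "length (R a) = K + length v" if "a \<in> T" for a
    using assms[OF that] by (simp add: R_def)
  have nb: "nonblank (R a) = v" for a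
    by (simp add: nonblank_def R_def filter_map o_def)
  have e: "entry (R a ! n) = zero_extend v (int n - int (m a))" if "n < K + length v" "a \<in> T" for a n
    using that assms[OF that(2)]
    by (auto simp: R_def nth_append zero_extend_def nat_diff_distrib')
  have "row_sqdist (R a) (R b) = (\<Sum>n<K + length v.
    (zero_extend v (int n - int (m a)) - zero_extend v (int n - int (m b)))\<^sup>2)" if "a \<in> T" "b \<in> T" for a b
    using that by (simp add: row_sqdist_def sum_list_sum_nth len atLeast0LessThan e)
  then show ?thesis
    unfolding realizes_def using len nb by blast
qed


section \<open>Spreads and Ramsey's theorem\<close>

definition unit_vec :: "nat \<Rightarrow> rinfty"
  where "unit_vec i = Abs_rinfty (\<lambda>j. if j = i then 1 else 0)"

lemma coord_unit_vec: "coord (unit_vec i) j = (if j = i then 1 else 0)"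
  unfolding unit_vec_def by (subst Abs_rinfty_inverse) auto

lemma inner_unit_vec: "inner (unit_vec i) (unit_vec j) = (if i = j then 1 else 0)"
  by (subst inner_rinfty_superset[of "{i}"]) (auto simp: coord_unit_vec)

definition spread_point :: "real list \<Rightarrow> nat list \<Rightarrow> rinfty"
  where "spread_point v xs = (\<Sum>(c, i)\<leftarrow>zip v xs. c *\<^sub>R unit_vec i)"

definition spread :: "real list \<Rightarrow> config"
  where "spread v = {spread_point v xs | xs. length xs = length v \<and> sorted_wrt (<) xs}"

lemma spread_point_eq_sum:
  "length xs = length v \<Longrightarrow> spread_point v xs = (\<Sum>t<length v. (v ! t) *\<^sub>R unit_vec (xs ! t))"
  by (simp add: spread_point_def sum_list_sum_nth atLeast0LessThan)

lemma inner_spread_point: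
  assumes "length xs = length v" "length ys = length w"
  shows "inner (spread_point v xs) (spread_point w ys) =
    (\<Sum>s<length v. \<Sum>t<length w. if xs ! s = ys ! t then v ! s * w ! t else 0)"
  using assms
  by (simp add: spread_point_eq_sum inner_sum_left inner_sum_right inner_unit_vec)
    (subst sum.swap, auto intro!: sum.cong simp: sum_distrib_left)

lemma dist_spread_point_distinct:
  assumes "length v = length xs" "length w = length xs" "distinct xs"
  shows "(dist (spread_point v xs) (spread_point w xs))\<^sup>2 = (\<Sum>(x, y)\<leftarrow>zip v w. (x - y)\<^sup>2)"
proof -
  define u where "u = map (\<lambda>(x, y). x - y) (zip v w)"
  have len: "length u = length xs" "length xs = length u"
    using assms by (simp_all add: u_def)
  have "spread_point v xs - spread_point w xs = spread_point u xs"
  proof -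
    have "spread_point v xs - spread_point w xs =
        (\<Sum>t<length xs. (v ! t) *\<^sub>R unit_vec (xs ! t) - (w ! t) *\<^sub>R unit_vec (xs ! t))"
      using assms by (simp only: spread_point_eq_sum sum_subtractf)
    also have "\<dots> = spread_point u xs"
      unfolding spread_point_eq_sum[OF len(2)] len(1)
      using assms(1,2) by (intro sum.cong refl) (simp add: u_def scaleR_diff_left)
    finally show ?thesis .
  qed
  then have "(dist (spread_point v xs) (spread_point w xs))\<^sup>2 = inner (spread_point u xs) (spread_point u xs)"
    by (simp add: dist_norm power2_norm_eq_inner)
  also have "\<dots> = (\<Sum>s<length u. \<Sum>t<length u. if s = t then u ! s * u ! t else 0)"
    unfolding inner_spread_point[OF len(2) len(2)] using assms(3) len
    by (intro sum.cong refl) (simp add: nth_eq_iff_index_eq)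
  also have "\<dots> = (\<Sum>s<length u. (u ! s)\<^sup>2)"
    by (simp add: power2_eq_square)
  also have "\<dots> = (\<Sum>(x, y)\<leftarrow>zip v w. (x - y)\<^sup>2)"
    using assms by (simp add: sum_list_sum_nth u_def atLeast0LessThan)
  finally show ?thesis .
qed

text \<open>Blanks contribute zero. Points with different index lists thus become vectors on common
  coordinates, where \<open>dist_spread_point_distinct\<close> applies.\<close>

lemma spread_point_nonblank:
  assumes "length r = length is"
  shows "spread_point (nonblank r) (map snd (filter (\<lambda>p. fst p \<noteq> None) (zip r is))) =
    spread_point (map entry r) is"
  using assms
  by (induction r "is" rule: list_induct2) (auto simp: spread_point_def nonblank_def)

lemma length_filter_zip_nonblank:
  "length r = length is \<Longrightarrow>
    length (map snd (filter (\<lambda>p. fst p \<noteq> None) (zip r is))) = length (nonblank r)"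
  by (induction r "is" rule: list_induct2) (auto simp: nonblank_def)

lemma sorted_wrt_map_snd_filter_zip:
  "length r = length is \<Longrightarrow> sorted_wrt (<) is \<Longrightarrow>
    sorted_wrt (<) (map snd (filter P (zip r is)))"
  by (induction r "is" rule: list_induct2) (auto dest: set_zip_rightD)

text \<open>The colouring is pulled back to index sets, so it is harmless that zero entries of
  \<open>v\<close> let several index sets give the same point.\<close>

lemma spread_monochromatic:
  fixes c :: "rinfty \<Rightarrow> nat"
  assumes "c ` spread v \<subseteq> {..<r}"
  obtains H k where "infinite H" "k < r"
    "\<And>xs. length xs = length v \<Longrightarrow> sorted_wrt (<) xs \<Longrightarrow> set xs \<subseteq> H \<Longrightarrow> c (spread_point v xs) = k"
proof -
  let ?f = "\<lambda>I. c (spread_point v (sorted_list_of_set I))"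
  have "?f I < r" if "finite I" "card I = length v" for I
    using that assms by (force simp: spread_def)
  then have "\<forall>I. I \<subseteq> UNIV \<and> finite I \<and> card I = length v \<longrightarrow> ?f I < r"
    by blast
  from Ramsey[OF infinite_UNIV_nat this]
  obtain H k where H: "infinite H" "k < r"
    "\<And>I. I \<subseteq> H \<Longrightarrow> finite I \<Longrightarrow> card I = length v \<Longrightarrow> ?f I = k"
    by auto
  show ?thesis
  proof (rule that[OF H(1,2)])
    fix xs
    assume xs: "length xs = length v" "sorted_wrt (<) xs" "set xs \<subseteq> H"
    have eq: "sorted_list_of_set (set xs) = xs"
      using xs(2) strict_sorted_iff sorted_list_of_set.idem_if_sorted_distinct by blast
    have "distinct xs"
      using xs(2) strict_sorted_iff by blast
    then show "c (spread_point v xs) = k"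
      using H(3)[OF xs(3) finite_set] xs(1) eq by (metis distinct_card)
  qed
qed

lemma arrows_spread:
  assumes "realizes S v (\<lambda>a b. (dist a b)\<^sup>2)"
  shows "arrows (spread v) S r"
  unfolding arrows_def
proof (intro allI impI)
  fix c :: "rinfty \<Rightarrow> nat"
  assume "c ` spread v \<subseteq> {..<r}"
  then obtain H k where H: "infinite H" "k < r"
    "\<And>xs. length xs = length v \<Longrightarrow> sorted_wrt (<) xs \<Longrightarrow> set xs \<subseteq> H \<Longrightarrow> c (spread_point v xs) = k"
    using spread_monochromatic by blast
  from assms obtain N R where R: "\<And>a. a \<in> S \<Longrightarrow> length (R a) = N \<and> nonblank (R a) = v"
    "\<And>a b. a \<in> S \<Longrightarrow> b \<in> S \<Longrightarrow> row_sqdist (R a) (R b) = (dist a b)\<^sup>2"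
    unfolding realizes_def by blast
  \<comment> \<open>All rows share these coordinates: column \<open>n\<close> sits at the
    \<open>n\<close>-th element of \<open>H\<close>. Dropping blanks leaves increasing index lists
    inside \<open>H\<close>, hence points of colour \<open>k\<close>.\<close>
  define hs where "hs = map (enumerate H) [0..<N]"
  have hs: "length hs = N" "sorted_wrt (<) hs" "set hs \<subseteq> H"
    using H(1) by (auto simp: hs_def sorted_wrt_iff_nth_less enumerate_in_set)
  then have "distinct hs"
    using strict_sorted_iff by blast
  define xs where "xs a = map snd (filter (\<lambda>p. fst p \<noteq> None) (zip (R a) hs))" for a
  define f where "f a = spread_point v (xs a)" for a
  have xs: "length (xs a) = length v" "sorted_wrt (<) (xs a)" "set (xs a) \<subseteq> H" if "a \<in> S" for a
    using R(1)[OF that] hs length_filter_zip_nonblank[of "R a" hs]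
      sorted_wrt_map_snd_filter_zip[of "R a" hs]
    by (auto simp: xs_def dest: set_zip_rightD)
  have f: "f a = spread_point (map entry (R a)) hs" if "a \<in> S" for a
    using R(1)[OF that] hs spread_point_nonblank[of "R a" hs] by (simp add: f_def xs_def)
  have "(dist (f a) (f b))\<^sup>2 = (dist a b)\<^sup>2" if "a \<in> S" "b \<in> S" for a b
  proof -
    have "(dist (f a) (f b))\<^sup>2 = row_sqdist (R a) (R b)"
      unfolding f[OF that(1)] f[OF that(2)] using R(1)[OF that(1)] R(1)[OF that(2)] hs \<open>distinct hs\<close>
      by (subst dist_spread_point_distinct) (simp_all add: row_sqdist_def zip_map_map o_def case_prod_unfold)
    then show ?thesis
      using R(2)[OF that] by simp
  qed
  then have dist: "dist (f a) (f b) = dist a b" if "a \<in> S" "b \<in> S" for a b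
    using that by (simp add: power2_eq_iff_nonneg)
  then have "inj_on f S"
    by (metis dist_eq_0_iff inj_onI)
  then have "is_copy S (f ` S)"
    unfolding is_copy_def using dist by (metis inj_on_imp_bij_betw)
  moreover have "f ` S \<subseteq> spread v" "\<forall>x\<in>f ` S. c x = k"
    using xs H(3) by (auto simp: f_def spread_def)
  ultimately show "\<exists>W k. W \<subseteq> spread v \<and> is_copy S W \<and> k < r \<and> (\<forall>x\<in>W. c x = k)"
    using H(2) by blast
qed


section \<open>Large free subsets of spreads\<close>

text \<open>By \<open>dist_compatible\<close> and \<open>sum_in_sq_subsums\<close>, half the squared
  distance of two points compatible with the same \<open>g\<close> lies in this set.\<close>

fun sq_subsums :: "real list \<Rightarrow> real set"
  where "sq_subsums [] = {0}"
  | "sq_subsums (x # xs) = sq_subsums xs \<union> (\<lambda>s. x\<^sup>2 + s) ` sq_subsums xs"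

lemma finite_sq_subsums: "finite (sq_subsums v)"
  by (induction v) auto

lemma sq_subsums_append:
  "s \<in> sq_subsums (v @ w) \<Longrightarrow> \<exists>a\<in>sq_subsums v. \<exists>b\<in>sq_subsums w. s = a + b"
proof (induction v arbitrary: s)
  case (Cons x v)
  from Cons.prems consider "s \<in> sq_subsums (v @ w)"
    | s' where "s' \<in> sq_subsums (v @ w)" "s = x\<^sup>2 + s'"
    by auto
  then show ?case
  proof cases
    case 1
    with Cons.IH show ?thesis
      by fastforce
  next
    case 2
    with Cons.IH obtain a b where "a \<in> sq_subsums v" "b \<in> sq_subsums w" "s = (x\<^sup>2 + a) + b"
      by (metis add.assoc)
    then show ?thesis
      by auto
  qed
qed simp

lemma sq_subsums_scale: "sq_subsums (map ((*) c) v) = (\<lambda>s. c\<^sup>2 * s) ` sq_subsums v"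
  by (induction v) (simp_all add: image_Un image_image distrib_left power_mult_distrib)

lemma sum_in_sq_subsums: "(\<Sum>t | t < length v \<and> P t. (v ! t)\<^sup>2) \<in> sq_subsums v"
proof (induction v arbitrary: P)
  case (Cons x v)
  have "{t. t < length (x # v) \<and> P t} = (if P 0 then {0} else {}) \<union> Suc ` {t. t < length v \<and> P (Suc t)}"
    by (auto simp: image_iff less_Suc_eq_0_disj)
  then have "(\<Sum>t | t < length (x # v) \<and> P t. ((x # v) ! t)\<^sup>2) =
      (if P 0 then x\<^sup>2 else 0) + (\<Sum>t | t < length v \<and> P (Suc t). (v ! t)\<^sup>2)"
    by (simp only:) (subst sum.union_disjoint, auto simp: sum.reindex)
  then show ?case
    using Cons[of "\<lambda>t. P (Suc t)"] by auto
qed simp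

definition compatible :: "(nat \<Rightarrow> nat) \<Rightarrow> nat list \<Rightarrow> bool"
  where "compatible g xs \<longleftrightarrow> (\<forall>t<length xs. g (xs ! t) = t)"

text \<open>An index shared by both lists has the same position in both, namely its value under
  \<open>g\<close>. So the inner product only sees the positions where the lists agree.\<close>

lemma dist_compatible:
  assumes len: "length xs = length v" "length ys = length v"
    and g: "compatible g xs" "compatible g ys"
  shows "(dist (spread_point v xs) (spread_point v ys))\<^sup>2 =
    2 * (\<Sum>t | t < length v \<and> xs ! t \<noteq> ys ! t. (v ! t)\<^sup>2)"
proof -
  have ip: "inner (spread_point v us) (spread_point v ws) =
      (\<Sum>t<length v. if us ! t = ws ! t then (v ! t)\<^sup>2 else 0)"
    if "length us = length v" "length ws = length v" "compatible g us" "compatible g ws" for us ws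
  proof -
    have eq: "s = t" if "us ! s = ws ! t" "s < length v" "t < length v" for s t
      using that \<open>length us = _\<close> \<open>length ws = _\<close> \<open>compatible g us\<close> \<open>compatible g ws\<close>
      unfolding compatible_def by metis
    have "inner (spread_point v us) (spread_point v ws) =
        (\<Sum>s<length v. \<Sum>t<length v. if s = t then (if us ! t = ws ! t then (v ! t)\<^sup>2 else 0) else 0)"
      unfolding inner_spread_point[OF that(1,2)]
      by (intro sum.cong refl) (auto simp: power2_eq_square dest!: eq)
    then show ?thesis
      by simp
  qed
  have "(dist (spread_point v xs) (spread_point v ys))\<^sup>2 =
      2 * ((\<Sum>t<length v. (v ! t)\<^sup>2) - (\<Sum>t<length v. if xs ! t = ys ! t then (v ! t)\<^sup>2 else 0))"
    using assms by (simp add: dist_norm power2_norm_eq_inner inner_diff_left inner_diff_right ip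
        inner_commute[of "spread_point v ys" "spread_point v xs"])
  also have "\<dots> = 2 * (\<Sum>t<length v. if xs ! t \<noteq> ys ! t then (v ! t)\<^sup>2 else 0)"
    by (simp flip: sum_subtractf) (intro sum.cong; simp)
  also have "(\<Sum>t<length v. if xs ! t \<noteq> ys ! t then (v ! t)\<^sup>2 else 0) =
      (\<Sum>t | t < length v \<and> xs ! t \<noteq> ys ! t. (v ! t)\<^sup>2)"
    by (subst sum.inter_filter[symmetric]) (auto intro: sum.cong)
  finally show ?thesis .
qed

text \<open>Compatibility prescribes \<open>g\<close> on the entries of \<open>xs\<close> and leaves
  it free on the rest of \<open>F\<close>; \<open>\<iota>\<close> extends a free choice by the
  prescribed values.\<close>

lemma card_compatible_ge:
  assumes "finite F" "set xs \<subseteq> F" "distinct xs"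
  shows "length xs ^ (card F - length xs) \<le>
    card {g \<in> F \<rightarrow>\<^sub>E {..<length xs}. compatible g xs}"
proof -
  let ?G = "(F - set xs) \<rightarrow>\<^sub>E {..<length xs}"
  define \<iota> where "\<iota> h x = (if x \<in> set xs then (THE t. t < length xs \<and> xs ! t = x) else h x)"
    for h :: "nat \<Rightarrow> nat" and x
  have \<iota>: "\<iota> h (xs ! t) = t" if "t < length xs" for h t
    using that assms(3) by (auto simp: \<iota>_def nth_eq_iff_index_eq)
  have "inj_on \<iota> ?G"
  proof (rule inj_onI)
    fix h h'
    assume h: "h \<in> ?G" "h' \<in> ?G" and eq: "\<iota> h = \<iota> h'"
    show "h = h'"
    proof (rule PiE_ext[OF h])
      fix x
      assume "x \<in> F - set xs"
      then show "h x = h' x"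
        using fun_cong[OF eq, of x] by (simp add: \<iota>_def)
    qed
  qed
  moreover have "\<iota> ` ?G \<subseteq> {g \<in> F \<rightarrow>\<^sub>E {..<length xs}. compatible g xs}"
  proof clarify
    fix h
    assume h: "h \<in> ?G"
    have "\<iota> h x < length xs" if "x \<in> F" for x
    proof (cases "x \<in> set xs")
      case True
      then show ?thesis
        using \<iota>[of _ h] by (auto simp: in_set_conv_nth)
    next
      case False
      then show ?thesis
        using that h by (auto simp: \<iota>_def)
    qed
    moreover have "\<iota> h x = undefined" if "x \<notin> F" for x
    proof -
      have "x \<notin> set xs"
        using that assms(2) by blast
      then show ?thesis
        using that PiE_arb[OF h, of x] by (simp add: \<iota>_def)
    qed
    ultimately show "\<iota> h \<in> F \<rightarrow>\<^sub>E {..<length xs} \<and> compatible (\<iota> h) xs"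
      using \<iota> by (auto simp: compatible_def)
  qed
  moreover have "finite {g \<in> F \<rightarrow>\<^sub>E {..<length xs}. compatible g xs}"
    using assms(1) by (simp add: finite_PiE)
  ultimately have "card ?G \<le> card {g \<in> F \<rightarrow>\<^sub>E {..<length xs}. compatible g xs}"
    using card_inj_on_le by blast
  moreover have "card ?G = length xs ^ (card F - length xs)"
    using assms by (simp add: card_PiE card_Diff_subset distinct_card)
  ultimately show ?thesis
    by simp
qed

text \<open>Averaging over all colourings of the coordinates by their \<open>k\<close> possible positions.\<close>

lemma exists_compatible_fraction:
  fixes I :: "'a \<Rightarrow> nat list"
  assumes "finite A" "\<And>y. y \<in> A \<Longrightarrow> length (I y) = k" "\<And>y. y \<in> A \<Longrightarrow> distinct (I y)"
  obtains g where "card A \<le> k ^ k * card {y \<in> A. compatible g (I y)}"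
proof (cases "A = {}")
  case True
  then show ?thesis
    using that by simp
next
  case False
  define F where "F = (\<Union>y\<in>A. set (I y))"
  have F: "finite F" "\<And>y. y \<in> A \<Longrightarrow> set (I y) \<subseteq> F"
    using assms(1) by (auto simp: F_def)
  obtain y0 where "y0 \<in> A"
    using False by blast
  then have "k \<le> card F"
    using F assms(2,3) by (metis card_mono distinct_card)
  let ?G = "F \<rightarrow>\<^sub>E {..<k}"
  have finG: "finite ?G"
    using F by (simp add: finite_PiE)
  show ?thesis
  proof (rule ccontr)
    assume "\<not> thesis"
    then have less: "k ^ k * card {y \<in> A. compatible g (I y)} < card A" for g
      using that by (meson not_le)
    have cardG: "card ?G = k ^ card F"
      using F by (simp add: card_PiE)
    \<comment> \<open>If \<open>k = 0\<close>, all index lists are empty, so \<open>F\<close> is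
      empty and the power is \<open>0 ^ 0 = 1\<close>.\<close>
    then have "card ?G \<noteq> 0"
      using assms(2) by (cases "k = 0") (auto simp: F_def)
    then have "?G \<noteq> {}"
      by auto
    \<comment> \<open>Compatible pairs of a point and a map are counted in two ways: by points from
      below, by maps from above.\<close>
    have "card A * k ^ card F = k ^ k * (\<Sum>y\<in>A. k ^ (card F - k))"
      using \<open>k \<le> card F\<close> by (simp flip: power_add)
    also have "\<dots> \<le> k ^ k * (\<Sum>y\<in>A. card {g \<in> ?G. compatible g (I y)})"
      using card_compatible_ge[OF F(1)] F(2) assms(2,3)
      by (intro mult_left_mono sum_mono) force+
    also have "(\<Sum>y\<in>A. card {g \<in> ?G. compatible g (I y)}) = (\<Sum>g\<in>?G. card {y \<in> A. compatible g (I y)})"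
      using sum_multicount_gen[OF assms(1) finG, of "\<lambda>y g. compatible g (I y)"
          "\<lambda>g. card {y \<in> A. compatible g (I y)}"] by simp
    also have "k ^ k * \<dots> = (\<Sum>g\<in>?G. k ^ k * card {y \<in> A. compatible g (I y)})"
      by (simp add: sum_distrib_left)
    also have "\<dots> < (\<Sum>g\<in>?G. card A)"
      using less finG \<open>?G \<noteq> {}\<close> by (intro sum_strict_mono) auto
    finally show False
      by (simp add: cardG)
  qed
qed

text \<open>A single pair \<open>p\<close>, \<open>q\<close> rules out all copies of
  \<open>X\<close>: its distance does not occur between points compatible with the same
  \<open>g\<close>.\<close>

lemma spread_sparse:
  assumes pq: "p \<in> X" "q \<in> X" "(dist p q)\<^sup>2 / 2 \<notin> sq_subsums v"
    and Y: "finite Y" "Y \<subseteq> spread v"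
  shows "\<exists>Z\<subseteq>Y. real (card Z) \<ge> 1 / real (length v ^ length v) * real (card Y) \<and> config_free X Z"
proof -
  let ?k = "length v"
  have "\<forall>y\<in>Y. \<exists>xs. y = spread_point v xs \<and> length xs = ?k \<and> distinct xs"
    using Y(2) strict_sorted_iff by (fastforce simp: spread_def)
  then obtain I where I: "\<And>y. y \<in> Y \<Longrightarrow> y = spread_point v (I y)"
    "\<And>y. y \<in> Y \<Longrightarrow> length (I y) = ?k" "\<And>y. y \<in> Y \<Longrightarrow> distinct (I y)"
    by metis
  obtain g where g: "card Y \<le> ?k ^ ?k * card {y \<in> Y. compatible g (I y)}"
    using exists_compatible_fraction[of Y I ?k] Y(1) I(2,3) by blast
  define Z where "Z = {y \<in> Y. compatible g (I y)}"
  have "?k ^ ?k > 0"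
    by (cases "?k = 0") auto
  then have "real (card Z) \<ge> 1 / real (?k ^ ?k) * real (card Y)"
  proof -
    have "real (card Y) \<le> real (?k ^ ?k) * real (card Z)"
      using g unfolding Z_def[symmetric] of_nat_mult[symmetric] of_nat_le_iff .
    then show ?thesis
      using \<open>?k ^ ?k > 0\<close> by (simp add: field_simps)
  qed
  moreover have "config_free X Z"
    unfolding config_free_def
  proof
    assume "\<exists>W\<subseteq>Z. is_copy X W"
    then obtain f where f: "f ` X \<subseteq> Z" "\<And>x y. x \<in> X \<Longrightarrow> y \<in> X \<Longrightarrow> dist (f x) (f y) = dist x y"
      unfolding is_copy_def bij_betw_def by blast
    let ?u = "f p" and ?w = "f q"
    have uw: "?u \<in> Y" "?w \<in> Y" "compatible g (I ?u)" "compatible g (I ?w)"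
      using f(1) pq by (auto simp: Z_def)
    have "(dist p q)\<^sup>2 = (dist (spread_point v (I ?u)) (spread_point v (I ?w)))\<^sup>2"
      using f(2)[OF pq(1,2)] I(1) uw by metis
    also have "\<dots> = 2 * (\<Sum>t | t < ?k \<and> I ?u ! t \<noteq> I ?w ! t. (v ! t)\<^sup>2)"
      using uw I by (intro dist_compatible) auto
    finally show False
      using pq(3) sum_in_sq_subsums[of v "\<lambda>t. I ?u ! t \<noteq> I ?w ! t"] by simp
  qed
  moreover have "Z \<subseteq> Y"
    by (auto simp: Z_def)
  ultimately show ?thesis
    by blast
qed

lemma P_RamseyI:
  assumes "finite S" "realizes S v (\<lambda>a b. (dist a b)\<^sup>2)"
    and "p \<in> S" "q \<in> S" "(dist p q)\<^sup>2 / 2 \<notin> sq_subsums v"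
  shows "P_Ramsey S"
proof -
  let ?\<mu> = "1 / real (length v ^ length v)"
  have "?\<mu> > 0"
    by (cases "length v = 0") auto
  moreover have "\<forall>r\<ge>1. arrows (spread v) S r"
    using arrows_spread[OF assms(2)] by blast
  moreover have "\<forall>Y. finite Y \<and> Y \<subseteq> spread v \<longrightarrow>
      (\<exists>Z\<subseteq>Y. real (card Z) \<ge> ?\<mu> * real (card Y) \<and> config_free S Z)"
    using spread_sparse[OF assms(3-5)] by blast
  ultimately show ?thesis
    unfolding P_Ramsey_def using assms(1) by blast
qed


section \<open>Approximating Euclidean metrics\<close>

definition tent :: "nat \<Rightarrow> int \<Rightarrow> real"
  where "tent L t = max 0 (real L - \<bar>real_of_int t - real L\<bar>)"

text \<open>The zeros at both ends are included, so the length is \<open>2 * L + 1\<close> with the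
  peak in the middle.\<close>

definition tent_list :: "nat \<Rightarrow> real list"
  where "tent_list L = map (\<lambda>t. tent L (int t)) [0..<2 * L + 1]"

lemma zero_extend_tent_list: "zero_extend (tent_list L) t = tent L t"
  by (auto simp: zero_extend_def tent_list_def tent_def simp del: upt_Suc)

lemma tent_Lipschitz: "\<bar>tent L s - tent L t\<bar> \<le> \<bar>real_of_int (s - t)\<bar>"
  unfolding tent_def by (simp add: max_def abs_if)

lemma tent_rising: "0 \<le> t \<Longrightarrow> t \<le> int L \<Longrightarrow> tent L t = real_of_int t"
  unfolding tent_def by (simp add: max_def abs_if)

lemma tent_falling: "int L \<le> t \<Longrightarrow> t \<le> 2 * int L \<Longrightarrow> tent L t = 2 * real L - real_of_int t"
  unfolding tent_def by (simp add: max_def abs_if)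

text \<open>
  A tent has slope of absolute value one on a stretch of length \<open>2 L\<close>, so that shifting
  it by \<open>h\<close> changes all but boundedly many of its values by exactly \<open>h\<close>.
\<close>

lemma tent_shift_sum:
  assumes "i \<le> j" "j \<le> K"
  shows "\<bar>(\<Sum>n<K + (2 * L + 1). (tent L (int n - int i) - tent L (int n - int j))\<^sup>2) -
    2 * real L * (real i - real j)\<^sup>2\<bar> \<le> (2 * real K + 1) * real K ^ 2"
proof -
  define h where "h = real j - real i"
  define f where "f n = (tent L (int n - int i) - tent L (int n - int j))\<^sup>2" for n
  define N where "N = K + (2 * L + 1)"
  have h: "0 \<le> h" "h \<le> real K"
    using assms by (auto simp: h_def)
  have hK: "h\<^sup>2 \<le> real K ^ 2"
    using h by (intro power_mono)
  have sq: "(real i - real j)\<^sup>2 = h\<^sup>2"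
    by (simp add: h_def power2_commute)
  have "f n \<le> h\<^sup>2" for n
    using tent_Lipschitz[of L "int n - int i" "int n - int j"] h(1)
    unfolding f_def by (subst abs_le_square_iff[symmetric]) (simp add: h_def)
  then have "(\<Sum>n<N. f n) \<le> (\<Sum>n<N. h\<^sup>2)"
    by (intro sum_mono)
  then have upper: "(\<Sum>n<N. f n) \<le> 2 * real L * h\<^sup>2 + (real K + 1) * h\<^sup>2"
    by (simp add: N_def algebra_simps)
  have lower: "(\<Sum>n<N. f n) \<ge> 2 * real L * h\<^sup>2 - 2 * real K * h\<^sup>2"
  proof (cases "i = j")
    case True
    then show ?thesis
      by (simp add: f_def h_def)
  next
    case False
    \<comment> \<open>On \<open>A\<close> both shifted tents rise, on \<open>B\<close> both fall, so
      they differ by exactly \<open>h\<close> in absolute value. For \<open>i = j\<close> the two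
      intervals would meet at the peak.\<close>
    define A B where "A = {j..i + L}" and "B = {j + L..i + 2 * L}"
    have "A \<inter> B = {}"
      using False assms by (auto simp: A_def B_def)
    have "A \<union> B \<subseteq> {..<N}"
      using assms by (auto simp: A_def B_def N_def)
    have "real (card A) \<ge> real L - real K" "real (card B) \<ge> real L - real K"
      using assms by (auto simp: A_def B_def)
    then have "(2 * real L - 2 * real K) * h\<^sup>2 \<le> real (card (A \<union> B)) * h\<^sup>2"
      using \<open>A \<inter> B = {}\<close> by (intro mult_right_mono) (auto simp: card_Un_disjoint A_def B_def)
    also have "\<dots> = (\<Sum>n\<in>A \<union> B. f n)"
    proof -
      have "f n = h\<^sup>2" if "n \<in> A \<union> B" for n
        using that assms
        by (auto simp: A_def B_def f_def h_def tent_rising tent_falling power2_commute)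
      then show ?thesis
        by simp
    qed
    also have "\<dots> \<le> (\<Sum>n<N. f n)"
      using \<open>A \<union> B \<subseteq> {..<N}\<close> by (intro sum_mono2) (auto simp: f_def)
    finally show ?thesis
      by (simp add: algebra_simps)
  qed
  have "(real K + 1) * h\<^sup>2 \<le> (2 * real K + 1) * real K ^ 2"
    "2 * real K * h\<^sup>2 \<le> (2 * real K + 1) * real K ^ 2"
    using hK by (auto intro!: mult_mono)
  with upper lower show ?thesis
    unfolding f_def[symmetric] N_def[symmetric] sq by linarith
qed

text \<open>The error in \<open>tent_shift_sum\<close> does not depend on \<open>L\<close>, so it
  becomes small after dividing squared distances by \<open>2 * L\<close> for large
  \<open>L\<close>.\<close>

lemma realizes_approx_nat:
  fixes m :: "'a \<Rightarrow> nat"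
  assumes "finite T" "e > 0"
  obtains v D where "realizes T v D"
    "\<And>a b. a \<in> T \<Longrightarrow> b \<in> T \<Longrightarrow> \<bar>D a b - (real (m a) - real (m b))\<^sup>2\<bar> < e"
proof -
  obtain K where K: "\<And>a. a \<in> T \<Longrightarrow> m a \<le> K"
    using assms(1) finite_nat_set_iff_bounded_le[of "m ` T"] by auto
  define C where "C = (2 * real K + 1) * real K ^ 2"
  have "C \<ge> 0"
    by (simp add: C_def)
  obtain L where L: "real L > C / (2 * e)"
    using reals_Archimedean2 by blast
  moreover have "C / (2 * e) \<ge> 0"
    using \<open>C \<ge> 0\<close> assms(2) by simp
  ultimately have "real L > 0"
    by linarith
  define D where "D a b = (\<Sum>n<K + (2 * L + 1).
    (tent L (int n - int (m a)) - tent L (int n - int (m b)))\<^sup>2)" for a b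
  have "realizes T (tent_list L) D"
    using realizes_shift[of T m K "tent_list L"] K
    unfolding D_def zero_extend_tent_list by (simp add: tent_list_def)
  from realizes_scale[OF this, of "1 / sqrt (2 * real L)"]
  have r: "realizes T (map ((*) (1 / sqrt (2 * real L))) (tent_list L)) (\<lambda>a b. D a b / (2 * real L))"
    by (simp add: power_divide)
  have D: "\<bar>D a b - 2 * real L * (real (m a) - real (m b))\<^sup>2\<bar> \<le> C" if "a \<in> T" "b \<in> T" for a b
    using tent_shift_sum[of "m a" "m b" K L] tent_shift_sum[of "m b" "m a" K L] K that
    unfolding D_def C_def by (cases "m a \<le> m b") (auto simp: power2_commute)
  show ?thesis
  proof (rule that[OF r])
    fix a b
    assume "a \<in> T" "b \<in> T"
    have "D a b / (2 * real L) - (real (m a) - real (m b))\<^sup>2 =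
        (D a b - 2 * real L * (real (m a) - real (m b))\<^sup>2) / (2 * real L)"
      using \<open>real L > 0\<close> by (simp add: field_simps)
    also have "\<bar>\<dots>\<bar> \<le> C / (2 * real L)"
      using D[OF \<open>a \<in> T\<close> \<open>b \<in> T\<close>] \<open>real L > 0\<close> by (simp add: divide_right_mono)
    also have "\<dots> < e"
      using L \<open>real L > 0\<close> assms(2) by (simp add: field_simps)
    finally show "\<bar>D a b / (2 * real L) - (real (m a) - real (m b))\<^sup>2\<bar> < e" .
  qed
qed

lemma tendsto_nat_floor_mult_div:
  assumes "y \<ge> 0"
  shows "(\<lambda>N. real (nat \<lfloor>real N * y\<rfloor>) / real N) \<longlonglongrightarrow> y"
proof (rule real_tendsto_sandwich)
  have eq: "real (nat \<lfloor>real N * y\<rfloor>) = of_int \<lfloor>real N * y\<rfloor>" for N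
    using assms by simp
  show "\<forall>\<^sub>F N in sequentially. y - 1 / real N \<le> real (nat \<lfloor>real N * y\<rfloor>) / real N"
    using eventually_gt_at_top[of 0]
  proof eventually_elim
    case (elim N)
    have "real N * y - 1 \<le> of_int \<lfloor>real N * y\<rfloor>"
      by linarith
    then have "(real N * y - 1) / real N \<le> of_int \<lfloor>real N * y\<rfloor> / real N"
      by (intro divide_right_mono) auto
    with elim show ?case
      unfolding eq by (simp add: diff_divide_distrib)
  qed
  show "\<forall>\<^sub>F N in sequentially. real (nat \<lfloor>real N * y\<rfloor>) / real N \<le> y"
    using eventually_gt_at_top[of 0]
  proof eventually_elim
    case (elim N)
    then show ?case
      unfolding eq by (simp add: field_simps)
  qed
  show "(\<lambda>N. y - 1 / real N) \<longlonglongrightarrow> y"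
    using tendsto_diff[OF tendsto_const lim_1_over_n, of y] by simp
qed simp

lemma realizes_approx_real:
  fixes x :: "'a \<Rightarrow> real"
  assumes "finite T" "e > 0"
  obtains v D where "realizes T v D"
    "\<And>a b. a \<in> T \<Longrightarrow> b \<in> T \<Longrightarrow> \<bar>D a b - (x a - x b)\<^sup>2\<bar> < e"
proof -
  \<comment> \<open>Translating by \<open>c\<close> makes all values nonnegative on
    \<open>T\<close>, so that \<open>nat\<close> truncates nothing.\<close>
  define c where "c = - (\<Sum>a\<in>T. \<bar>x a\<bar>)"
  have c: "x a - c \<ge> 0" if "a \<in> T" for a
    using member_le_sum[OF that, of "\<lambda>a. \<bar>x a\<bar>"] assms(1) by (simp add: c_def)
  define m where "m N a = nat \<lfloor>real N * (x a - c)\<rfloor>" for N a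
  have "\<forall>\<^sub>F N in sequentially. \<bar>(real (m N a) / real N - real (m N b) / real N)\<^sup>2 - (x a - x b)\<^sup>2\<bar> < e / 2"
    if "a \<in> T" "b \<in> T" for a b
  proof -
    have "(\<lambda>N. (real (m N a) / real N - real (m N b) / real N)\<^sup>2) \<longlonglongrightarrow> ((x a - c) - (x b - c))\<^sup>2"
      unfolding m_def using that by (intro tendsto_intros tendsto_nat_floor_mult_div c)
    then show ?thesis
      using assms(2) by (auto simp: tendsto_iff dist_real_def dest!: spec[of _ "e / 2"])
  qed
  then have "\<forall>\<^sub>F N in sequentially. \<forall>a\<in>T. \<forall>b\<in>T.
      \<bar>(real (m N a) / real N - real (m N b) / real N)\<^sup>2 - (x a - x b)\<^sup>2\<bar> < e / 2"
    using assms(1) by (simp add: eventually_ball_finite_distrib)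
  then have "\<forall>\<^sub>F N in sequentially. N > 0 \<and> (\<forall>a\<in>T. \<forall>b\<in>T.
      \<bar>(real (m N a) / real N - real (m N b) / real N)\<^sup>2 - (x a - x b)\<^sup>2\<bar> < e / 2)"
    by (intro eventually_conj eventually_gt_at_top)
  from eventually_happens'[OF sequentially_bot this]
  obtain N where N: "N > 0" "\<And>a b. a \<in> T \<Longrightarrow> b \<in> T \<Longrightarrow>
      \<bar>(real (m N a) / real N - real (m N b) / real N)\<^sup>2 - (x a - x b)\<^sup>2\<bar> < e / 2"
    by blast
  \<comment> \<open>The integer points are scaled back by \<open>1 / N\<close>, which divides the
    error by the square of \<open>N\<close>.\<close>
  have "(real N)\<^sup>2 * (e / 2) > 0"
    using N(1) assms(2) by simp
  then obtain v D where D: "realizes T v D" "\<And>a b. a \<in> T \<Longrightarrow> b \<in> T \<Longrightarrow>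
      \<bar>D a b - (real (m N a) - real (m N b))\<^sup>2\<bar> < (real N)\<^sup>2 * (e / 2)"
    using realizes_approx_nat[OF assms(1), of _ "m N"] by metis
  show ?thesis
  proof (rule that[OF realizes_scale[OF D(1), of "1 / real N"]])
    fix a b
    assume ab: "a \<in> T" "b \<in> T"
    have "(1 / real N)\<^sup>2 * D a b - (real (m N a) / real N - real (m N b) / real N)\<^sup>2 =
        (D a b - (real (m N a) - real (m N b))\<^sup>2) / (real N)\<^sup>2"
      by (simp add: power_divide diff_divide_distrib[symmetric])
    then have "\<bar>(1 / real N)\<^sup>2 * D a b - (real (m N a) / real N - real (m N b) / real N)\<^sup>2\<bar> < e / 2"
      using D(2)[OF ab] N(1) by (simp add: field_simps)
    with N(2)[OF ab] show "\<bar>(1 / real N)\<^sup>2 * D a b - (x a - x b)\<^sup>2\<bar> < e"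
      by linarith
  qed
qed

text \<open>One block per coordinate, each new one taking half of the tolerance.\<close>

lemma realizes_approx_sum:
  fixes x :: "'a \<Rightarrow> 'i \<Rightarrow> real"
  assumes "finite A" "finite T" "e > 0"
  shows "\<exists>v D. realizes T v D \<and>
    (\<forall>a\<in>T. \<forall>b\<in>T. \<bar>D a b - (\<Sum>i\<in>A. (x a i - x b i)\<^sup>2)\<bar> < e)"
  using assms(1,3)
proof (induction A arbitrary: e rule: finite_induct)
  case empty
  then show ?case
    using realizes_Nil[of T] by (intro exI[of _ "[]"] exI[of _ "\<lambda>_ _. 0"]) simp
next
  case (insert i A)
  from insert.IH[of "e / 2"] insert.prems obtain v D where D: "realizes T v D"
    "\<And>a b. a \<in> T \<Longrightarrow> b \<in> T \<Longrightarrow> \<bar>D a b - (\<Sum>i\<in>A. (x a i - x b i)\<^sup>2)\<bar> < e / 2"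
    by auto
  from realizes_approx_real[OF assms(2), of "e / 2" "\<lambda>a. x a i"] insert.prems
  obtain w E where E: "realizes T w E"
    "\<And>a b. a \<in> T \<Longrightarrow> b \<in> T \<Longrightarrow> \<bar>E a b - (x a i - x b i)\<^sup>2\<bar> < e / 2"
    by auto
  have "\<bar>D a b + E a b - (\<Sum>i\<in>insert i A. (x a i - x b i)\<^sup>2)\<bar> < e" if "a \<in> T" "b \<in> T" for a b
    using D(2)[OF that] E(2)[OF that] unfolding sum.insert[OF insert.hyps] by linarith
  then show ?case
    using realizes_append[OF D(1) E(1)] by blast
qed

text \<open>Multiplying squared distances by \<sigma> slightly below 1 barely changes the metric but
  moves every nonzero subset sum. As \<open>0\<close> is not in \<open>F\<close>, only finitely many
  \<sigma> hit \<open>F\<close>.\<close>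

lemma realizes_approx_generic:
  fixes x :: "'a \<Rightarrow> 'i \<Rightarrow> real"
  assumes "finite A" "finite T" "e > 0" "finite F" "0 \<notin> F"
  obtains v D where "realizes T v D"
    "\<And>a b. a \<in> T \<Longrightarrow> b \<in> T \<Longrightarrow> \<bar>D a b - (\<Sum>i\<in>A. (x a i - x b i)\<^sup>2)\<bar> < e"
    "sq_subsums v \<inter> F = {}"
proof -
  from realizes_approx_sum[OF assms(1,2), of "e / 2" x] assms(3)
  obtain v D where D: "realizes T v D"
    "\<And>a b. a \<in> T \<Longrightarrow> b \<in> T \<Longrightarrow> \<bar>D a b - (\<Sum>i\<in>A. (x a i - x b i)\<^sup>2)\<bar> < e / 2"
    by auto
  define M where "M = 1 + (\<Sum>a\<in>T. \<Sum>b\<in>T. \<bar>D a b\<bar>)"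
  have M: "\<bar>D a b\<bar> \<le> M" if "a \<in> T" "b \<in> T" for a b
  proof -
    have "\<bar>D a b\<bar> \<le> (\<Sum>b\<in>T. \<bar>D a b\<bar>)"
      using that assms(2) by (intro member_le_sum[of b T]) auto
    also have "\<dots> \<le> (\<Sum>a\<in>T. \<Sum>b\<in>T. \<bar>D a b\<bar>)"
      using that assms(2) by (intro member_le_sum[of a T "\<lambda>a. \<Sum>b\<in>T. \<bar>D a b\<bar>"]) (auto simp: sum_nonneg)
    finally show ?thesis
      by (simp add: M_def)
  qed
  have "M > 0"
    by (simp add: M_def sum_nonneg add_pos_nonneg)
  \<comment> \<open>For \<open>u = 0\<close> the quotient is 0 by convention, which adds only a
    harmless value.\<close>
  define bad where "bad = (\<lambda>(c, u). c / u) ` (F \<times> sq_subsums v)"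
  have "finite bad"
    using assms(4) finite_sq_subsums by (auto simp: bad_def)
  \<comment> \<open>The lower end makes \<open>(1 - \<sigma>) * M\<close> at most
    \<open>e / 2\<close>, the half of the tolerance left over from the approximation.\<close>
  have "infinite {max 0 (1 - e / (2 * M))<..<1}"
    using assms(3) \<open>M > 0\<close> by (intro infinite_Ioo) auto
  from Diff_infinite_finite[OF \<open>finite bad\<close> this]
  have "{max 0 (1 - e / (2 * M))<..<1} - bad \<noteq> {}"
    by (metis finite.emptyI)
  then obtain \<sigma> where "\<sigma> \<in> {max 0 (1 - e / (2 * M))<..<1} - bad"
    by blast
  then have \<sigma>: "\<sigma> \<notin> bad" "0 < \<sigma>" "\<sigma> < 1" "1 - e / (2 * M) < \<sigma>"
    by auto
  have r: "realizes T (map ((*) (sqrt \<sigma>)) v) (\<lambda>a b. \<sigma> * D a b)"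
    using realizes_scale[OF D(1), of "sqrt \<sigma>"] \<sigma>(2) by simp
  show ?thesis
  proof (rule that[OF r])
    fix a b
    assume ab: "a \<in> T" "b \<in> T"
    have "(1 - \<sigma>) * \<bar>D a b\<bar> \<le> (1 - \<sigma>) * M"
      using M[OF ab] \<sigma>(3) by (intro mult_left_mono) auto
    also have "\<dots> \<le> e / 2"
      using \<sigma>(4) \<open>M > 0\<close> by (simp add: field_simps)
    also have "(1 - \<sigma>) * \<bar>D a b\<bar> = \<bar>(1 - \<sigma>) * D a b\<bar>"
      using \<sigma>(3) by (simp add: abs_mult)
    finally have "\<bar>D a b - \<sigma> * D a b\<bar> \<le> e / 2"
      by (simp add: left_diff_distrib)
    with D(2)[OF ab] show "\<bar>\<sigma> * D a b - (\<Sum>i\<in>A. (x a i - x b i)\<^sup>2)\<bar> < e"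
      by linarith
  next
    have False if "\<sigma> * u \<in> F" "u \<in> sq_subsums v" for u
    proof -
      have "u \<noteq> 0"
        using that(1) assms(5) by auto
      then have "\<sigma> = \<sigma> * u / u"
        by simp
      then have "\<sigma> \<in> bad"
        unfolding bad_def using that by force
      with \<sigma>(1) show False ..
    qed
    then show "sq_subsums (map ((*) (sqrt \<sigma>)) v) \<inter> F = {}"
      using \<sigma>(2) by (auto simp: sq_subsums_scale)
  qed
qed


section \<open>Contracting affinely independent sets\<close>

text \<open>A Gram-Schmidt step: \<open>b - z\<close> is the part of \<open>b\<close> orthogonal to
  \<open>B\<close>, and the projection onto the larger span differs from \<open>y\<close> by a
  multiple of it.\<close>

lemma orthogonal_projection_exists:
  fixes x :: "'a::real_inner"
  assumes "finite B"
  shows "\<exists>y\<in>span B. \<forall>b\<in>B. inner (x - y) b = 0"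
  using assms
proof (induction B arbitrary: x rule: finite_induct)
  case empty
  then show ?case
    by (auto simp: span_0)
next
  case (insert b B)
  obtain y where y: "y \<in> span B" "\<And>c. c \<in> B \<Longrightarrow> inner (x - y) c = 0"
    using insert.IH by blast
  obtain z where z: "z \<in> span B" "\<And>c. c \<in> B \<Longrightarrow> inner (b - z) c = 0"
    using insert.IH by blast
  have orth: "inner u s = 0" if "s \<in> span B" "\<And>c. c \<in> B \<Longrightarrow> inner u c = 0" for u s
    using that(1)
    by (induction rule: span_induct_alt) (auto simp: inner_add_right that(2))
  \<comment> \<open>If \<open>b = z\<close>, division by zero gives \<open>k = 0\<close>, which is
    right because \<open>b\<close> already lies in the span of \<open>B\<close>.\<close>
  define k where "k = inner (x - y) (b - z) / inner (b - z) (b - z)"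
  define p where "p = y + k *\<^sub>R (b - z)"
  have "p \<in> span (insert b B)"
    unfolding p_def using y(1) z(1)
    by (meson insertI1 span_add span_base span_diff span_mono span_scale subsetD subset_insertI)
  moreover have B: "inner (x - p) c = 0" if "c \<in> B" for c
    using y(2)[OF that] z(2)[OF that] by (simp add: p_def inner_diff_left inner_add_left)
  moreover have "inner (x - p) b = 0"
  proof -
    have "inner (x - p) z = 0"
      using orth[OF z(1) B] .
    moreover have "inner (x - p) (b - z) = 0"
    proof -
      have "inner (x - p) (b - z) = inner (x - y) (b - z) - k * inner (b - z) (b - z)"
        by (simp add: p_def inner_diff_left inner_add_left)
      then show ?thesis
        by (cases "b = z") (simp_all add: k_def)
    qed
    ultimately show ?thesis
      by (simp add: inner_diff_right)
  qed
  ultimately show ?case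
    by blast
qed

text \<open>Take the component \<open>z\<close> of \<open>a - b0\<close> orthogonal to the affine
  hull of the other points. It is nonzero by affine independence, and dividing by
  \<open>inner z z\<close> normalizes it.\<close>

lemma affine_independent_dual:
  fixes S :: "'a::real_inner set"
  assumes "finite S" "\<not> affine_dependent S" "a \<in> S"
  shows "\<exists>u. \<forall>b\<in>S - {a}. inner u (a - b) = 1"
proof (cases "S - {a} = {}")
  case False
  then obtain b0 where b0: "b0 \<in> S - {a}"
    by blast
  let ?B = "{x - b0 | x. x \<in> S - {a} - {b0}}"
  have "finite ?B"
    using assms(1) by simp
  from orthogonal_projection_exists[OF this, of "a - b0"]
  obtain y where y: "y \<in> span ?B" "\<And>c. c \<in> ?B \<Longrightarrow> inner (a - b0 - y) c = 0"
    by blast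
  define z where "z = a - b0 - y"
  have "a \<notin> affine hull (S - {a})"
    using assms(2,3) by (auto simp: affine_dependent_def)
  then have "z \<noteq> 0"
    unfolding affine_hull_span[OF b0] z_def using y(1) by (auto simp: algebra_simps)
  have y': "inner z y = 0"
    using y(1)
    by (induction rule: span_induct_alt) (use y(2) in \<open>auto simp: inner_add_right simp flip: z_def\<close>)
  have zb: "inner z (b - b0) = 0" if "b \<in> S - {a}" for b
    using that y(2)[of "b - b0"] by (cases "b = b0") (auto simp: z_def)
  have "inner z (a - b) = inner z z" if "b \<in> S - {a}" for b
  proof -
    have "a - b = z + y - (b - b0)"
      by (simp add: z_def)
    then show ?thesis
      using y' zb[OF that] by (simp only: inner_add_right inner_diff_right)
  qed
  then show ?thesis
    using \<open>z \<noteq> 0\<close> by (intro exI[of _ "z /\<^sub>R inner z z"]) simp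
qed auto

text \<open>The \<open>w a\<close> are multiples of the gradients of the barycentric coordinates.\<close>

lemma affine_independent_contraction:
  fixes S :: "'a::real_inner set"
  assumes "finite S" "\<not> affine_dependent S"
  obtains w where "\<And>a b t. a \<in> S \<Longrightarrow> b \<in> S \<Longrightarrow> a \<noteq> b \<Longrightarrow>
    (dist (a + t *\<^sub>R w a) (b + t *\<^sub>R w b))\<^sup>2 = (dist a b)\<^sup>2 - t + t\<^sup>2 * (dist (w a) (w b))\<^sup>2"
proof -
  from affine_independent_dual[OF assms] obtain u
    where u: "\<And>a b. a \<in> S \<Longrightarrow> b \<in> S \<Longrightarrow> a \<noteq> b \<Longrightarrow> inner (u a) (a - b) = 1"
    by (metis Diff_iff singletonD)
  \<comment> \<open>Each of \<open>u a\<close> and \<open>u b\<close> contributes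
    \<open>- 1 / 4\<close> to the inner product of \<open>a - b\<close> and
    \<open>w a - w b\<close>; the factor \<open>2 * t\<close> of the cross term turns the total
    \<open>- 1 / 2\<close> into \<open>- t\<close>.\<close>
  define w where "w a = (- 1 / 4) *\<^sub>R u a" for a
  show ?thesis
  proof (rule that)
    fix a b t
    assume ab: "a \<in> S" "b \<in> S" "a \<noteq> b"
    have "inner (a - b) (w a - w b) = - (inner (u a) (a - b) + inner (u b) (b - a)) / 4"
      by (simp add: w_def inner_diff_left inner_diff_right inner_commute field_simps)
    then have ip: "inner (a - b) (w a - w b) = - 1 / 2"
      using u[of a b] u[of b a] ab by simp
    have "(dist (a + t *\<^sub>R w a) (b + t *\<^sub>R w b))\<^sup>2 = (norm ((a - b) + t *\<^sub>R (w a - w b)))\<^sup>2"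
      by (simp add: dist_norm algebra_simps)
    also have "\<dots> = (norm (a - b))\<^sup>2 + 2 * t * inner (a - b) (w a - w b) + t\<^sup>2 * (norm (w a - w b))\<^sup>2"
      unfolding power2_norm_eq_inner
      by (simp only: inner_add_left inner_add_right inner_scaleR_left inner_scaleR_right
          inner_commute[of "w a - w b" "a - b"] power2_eq_square) (simp add: algebra_simps)
    finally show "(dist (a + t *\<^sub>R w a) (b + t *\<^sub>R w b))\<^sup>2 =
        (dist a b)\<^sup>2 - t + t\<^sup>2 * (dist (w a) (w b))\<^sup>2"
      by (simp add: ip dist_norm)
  qed
qed


section \<open>Almost constant metrics\<close>

lemma sum_zero_extend_pair:
  assumes "m \<le> K"
  shows "(\<Sum>n<K + 2. zero_extend [x, y] (int n - int m) * f n) = x * f m + y * f (Suc m)"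
proof -
  have "zero_extend [x, y] (int n - int m) * f n =
      (if n = m then x * f m else 0) + (if n = Suc m then y * f (Suc m) else 0)" for n
    by (auto simp: zero_extend_def nth_Cons' split: if_splits)
  then show ?thesis
    using assms by (simp add: sum.distrib)
qed

text \<open>
  The rows of \<open>p\<close> and \<open>q\<close> are shifts by \<open>0\<close> and \<open>1\<close>, all other rows are far apart.
\<close>

lemma realizes_pair:
  assumes "finite T" "p \<noteq> q"
  shows "realizes T [x, y] (\<lambda>a b. if a = b then 0 else
    2 * (x\<^sup>2 + y\<^sup>2) - (if (p, q) = (a, b) \<or> (p, q) = (b, a) then 2 * (x * y) else 0))"
proof -
  obtain g :: "'a \<Rightarrow> nat" where g: "inj_on g T"
    using finite_imp_inj_to_nat_seg[OF assms(1)] by blast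
  \<comment> \<open>A row fills columns \<open>m a\<close> and \<open>m a + 1\<close>. Those of
    \<open>p\<close> and \<open>q\<close> share only column 1, where \<open>y\<close> meets
    \<open>x\<close>; the others start at distinct odd columns from 3 on and meet no other
    row.\<close>
  define m where "m a = (if a = p then 0 else if a = q then 1 else 3 + 2 * g a)" for a
  obtain K where K: "\<And>a. a \<in> T \<Longrightarrow> m a \<le> K"
    using assms(1) finite_nat_set_iff_bounded_le[of "m ` T"] by auto
  let ?z = "\<lambda>a n. zero_extend [x, y] (int n - int (m a))"
  have metric: "(\<Sum>n<K + length [x, y]. (?z a n - ?z b n)\<^sup>2) = (if a = b then 0 else
      2 * (x\<^sup>2 + y\<^sup>2) - (if (p, q) = (a, b) \<or> (p, q) = (b, a) then 2 * (x * y) else 0))"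
    if ab: "a \<in> T" "b \<in> T" for a b
  proof -
    have expand: "(\<Sum>n<N. (f n - h n)\<^sup>2) =
        (\<Sum>n<N. f n * f n) + (\<Sum>n<N. h n * h n) - 2 * (\<Sum>n<N. f n * h n)"
      for f h :: "nat \<Rightarrow> real" and N
      by (simp add: power2_eq_square algebra_simps sum.distrib sum_subtractf sum_distrib_left)
    have "(\<Sum>n<K + length [x, y]. (?z a n - ?z b n)\<^sup>2) =
        (\<Sum>n<K + 2. ?z a n * ?z a n) + (\<Sum>n<K + 2. ?z b n * ?z b n) - 2 * (\<Sum>n<K + 2. ?z a n * ?z b n)"
      unfolding expand by simp
    also have "\<dots> = 2 * (x\<^sup>2 + y\<^sup>2) - 2 * (x * ?z b (m a) + y * ?z b (Suc (m a)))"
      unfolding sum_zero_extend_pair[OF K[OF ab(1)]] sum_zero_extend_pair[OF K[OF ab(2)]]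
      by (simp add: zero_extend_def power2_eq_square)
    also have "x * ?z b (m a) + y * ?z b (Suc (m a)) = (if a = b then x\<^sup>2 + y\<^sup>2 else
        if (p, q) = (a, b) \<or> (p, q) = (b, a) then x * y else 0)"
    proof (cases "a = b")
      case True
      then show ?thesis
        by (simp add: zero_extend_def power2_eq_square)
    next
      case False
      then have "g a \<noteq> g b"
        using g ab by (auto dest: inj_onD)
      then show ?thesis
        using False assms(2) by (auto simp: m_def zero_extend_def nth_Cons' split: if_splits)
    qed
    finally show ?thesis
      by simp
  qed
  show ?thesis
    by (rule realizes_cong[OF realizes_shift[of T m K "[x, y]", OF K] metric])
qed

text \<open>The product of the two entries is \<open>\<beta> e\<close> whatever \<open>y\<close> is,
  so \<open>y\<close> stays a free parameter that affects only the common part of the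
  distances.\<close>

definition pair_block :: "('e \<Rightarrow> real) \<Rightarrow> 'e list \<Rightarrow> real \<Rightarrow> real list"
  where "pair_block \<beta> es y = concat (map (\<lambda>e. [\<beta> e / y, y]) es)"

lemma realizes_pair_block:
  fixes \<beta> :: "'a \<times> 'a \<Rightarrow> real"
  assumes "finite T" "y \<noteq> 0" "\<And>e. e \<in> set es \<Longrightarrow> fst e \<noteq> snd e"
  shows "realizes T (pair_block \<beta> es y) (\<lambda>a b. if a = b then 0 else
    2 * (\<Sum>e\<leftarrow>es. (\<beta> e / y)\<^sup>2 + y\<^sup>2) - 2 * (\<Sum>e\<leftarrow>es. if e = (a, b) \<or> e = (b, a) then \<beta> e else 0))"
  using assms(3)
proof (induction es)
  case Nil
  show ?case
    unfolding pair_block_def list.map concat.simps by (rule realizes_cong[OF realizes_Nil]) simp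
next
  case (Cons e es)
  obtain p q where e: "e = (p, q)"
    by (cases e)
  have "realizes T ([\<beta> e / y, y] @ pair_block \<beta> es y) (\<lambda>a b.
      (if a = b then 0 else 2 * ((\<beta> e / y)\<^sup>2 + y\<^sup>2) -
        (if (p, q) = (a, b) \<or> (p, q) = (b, a) then 2 * (\<beta> e / y * y) else 0)) +
      (if a = b then 0 else 2 * (\<Sum>e\<leftarrow>es. (\<beta> e / y)\<^sup>2 + y\<^sup>2) -
        2 * (\<Sum>e\<leftarrow>es. if e = (a, b) \<or> e = (b, a) then \<beta> e else 0)))"
    using Cons.IH Cons.prems[of "(p, q)"] Cons.prems e
    by (intro realizes_append realizes_pair assms(1)) auto
  then show ?case
    unfolding pair_block_def using assms(2)
    by simp (erule realizes_cong, auto simp: e)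
qed

text \<open>Here \<open>i\<close> counts the chosen entries \<open>y\<close>, and \<open>j\<close>
  collects the squares from the chosen entries \<open>\<beta> e / y\<close>. Multiplied by the
  square of \<open>y\<close>, this is quadratic in that square.\<close>

lemma sq_subsums_pair_block:
  assumes "y \<noteq> 0" "s \<in> sq_subsums (pair_block \<beta> es y)"
  shows "\<exists>i\<le>length es. \<exists>j\<in>sq_subsums (map \<beta> es). s = real i * y\<^sup>2 + j / y\<^sup>2"
  using assms(2)
proof (induction es arbitrary: s)
  case Nil
  then show ?case
    by (simp add: pair_block_def)
next
  case (Cons e es)
  then have "s \<in> sq_subsums ([\<beta> e / y, y] @ pair_block \<beta> es y)"
    by (simp add: pair_block_def)
  then obtain u s' where u: "u \<in> sq_subsums [\<beta> e / y, y]" "s' \<in> sq_subsums (pair_block \<beta> es y)" "s = u + s'"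
    using sq_subsums_append by blast
  then obtain i j where ij: "i \<le> length es" "j \<in> sq_subsums (map \<beta> es)" "s' = real i * y\<^sup>2 + j / y\<^sup>2"
    using Cons.IH by blast
  from u(1) consider "u = 0" | "u = y\<^sup>2" | "u = (\<beta> e)\<^sup>2 / y\<^sup>2" | "u = (\<beta> e)\<^sup>2 / y\<^sup>2 + y\<^sup>2"
    by (auto simp: power_divide)
  then show ?case
  proof cases
    case 1
    then show ?thesis
      using ij u(3) by (intro exI[of _ i]) auto
  next
    case 2
    then show ?thesis
      using ij u(3) by (intro exI[of _ "Suc i"]) (auto simp: algebra_simps intro!: bexI[of _ j])
  next
    case 3
    then show ?thesis
      using ij u(3) by (intro exI[of _ i])
        (auto simp: add_divide_distrib algebra_simps intro!: bexI[of _ "(\<beta> e)\<^sup>2 + j"])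
  next
    case 4
    then show ?thesis
      using ij u(3) by (intro exI[of _ "Suc i"])
        (auto simp: add_divide_distrib algebra_simps intro!: bexI[of _ "(\<beta> e)\<^sup>2 + j"])
  qed
qed

text \<open>The leading coefficient may vanish, as it does for \<open>i = 0\<close> or
  \<open>i = n\<close> in the application.\<close>

lemma finite_quadratic_roots:
  fixes a b c :: real
  assumes "b \<noteq> 0"
  shows "finite {w. a * w\<^sup>2 + b * w + c = 0}"
proof -
  have "finite {w. poly [:c, b, a:] w = 0}"
    using assms by (intro poly_roots_finite) auto
  moreover have "poly [:c, b, a:] w = a * w\<^sup>2 + b * w + c" for w
    by (simp add: algebra_simps power2_eq_square)
  ultimately show ?thesis
    by (simp only:)
qed

text \<open>
  In terms of \<open>w = y\<^sup>2\<close>, each subset sum equal to \<open>\<delta>\<close> means a quadratic equation for \<open>w\<close> whose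
  linear coefficient is nonzero by the assumptions on \<open>U\<close>.
\<close>

lemma realizes_almost_regular:
  fixes M :: "'a \<Rightarrow> 'a \<Rightarrow> real"
  assumes fin: "finite T" and ne: "p \<in> T" "q \<in> T" "p \<noteq> q"
    and sym: "\<And>a b. a \<in> T \<Longrightarrow> b \<in> T \<Longrightarrow> M a b = M b a"
    and \<Lambda>: "\<Lambda> > 0"
    and M: "\<And>a b. a \<in> T \<Longrightarrow> b \<in> T \<Longrightarrow> a \<noteq> b \<Longrightarrow> \<bar>M a b - 2 * \<Lambda>\<bar> \<le> \<Lambda> / (card T)\<^sup>2"
    and U: "finite U" "\<delta> \<notin> U" "\<delta> - \<Lambda> \<notin> U"
  obtains v where "realizes T v (\<lambda>a b. if a = b then 0 else M a b)"
    "\<And>u s. u \<in> U \<Longrightarrow> s \<in> sq_subsums v \<Longrightarrow> u + s \<noteq> \<delta>"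
proof -
  have "finite {(a, b) \<in> T \<times> T. a \<noteq> b}"
    by (rule finite_subset[of _ "T \<times> T"]) (use fin in auto)
  then obtain es where es: "set es = {(a, b) \<in> T \<times> T. a \<noteq> b}" "distinct es"
    using finite_distinct_list by blast
  define n where "n = real (length es)"
  have "n \<ge> 1"
  proof -
    have "(p, q) \<in> set es"
      using ne es(1) by simp
    then show ?thesis
      unfolding n_def by (cases es) auto
  qed
  have n_le: "n \<le> real ((card T)\<^sup>2)"
  proof -
    have "length es = card (set es)"
      using es(2) by (simp add: distinct_card)
    also have "\<dots> \<le> card (T \<times> T)"
      unfolding es(1) using fin by (intro card_mono) auto
    finally show ?thesis
      unfolding n_def by (simp only: of_nat_le_iff card_cartesian_product power2_eq_square)
  qed
  \<comment> \<open>Both orders of a pair occur in \<open>es\<close>, so its squared distance drops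
    by \<open>4 * \<beta> e\<close> from the common value \<open>2 * \<Lambda>\<close>; this must
    give \<open>M\<close>.\<close>
  define \<beta> where "\<beta> e = (\<Lambda> - M (fst e) (snd e) / 2) / 2" for e
  define B where "B = (\<Sum>e\<leftarrow>es. (\<beta> e)\<^sup>2)"
  have "\<bar>\<beta> e\<bar> \<le> \<Lambda> / (4 * n)" if "e \<in> set es" for e
  proof -
    have "\<bar>M (fst e) (snd e) - 2 * \<Lambda>\<bar> \<le> \<Lambda> / (card T)\<^sup>2"
    proof -
      have "fst e \<in> T" "snd e \<in> T" "fst e \<noteq> snd e"
        using that unfolding es(1) by (simp_all add: case_prod_unfold)
      then show ?thesis
        by (rule M)
    qed
    also have "\<dots> \<le> \<Lambda> / n"
    proof (rule divide_left_mono)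
      show "0 < real ((card T)\<^sup>2) * n"
        using n_le \<open>n \<ge> 1\<close> by (intro mult_pos_pos) linarith+
    qed (use n_le \<Lambda> in auto)
    finally have "\<bar>M (fst e) (snd e) - 2 * \<Lambda>\<bar> / 4 \<le> \<Lambda> / n / 4"
      by simp
    moreover have "\<bar>\<beta> e\<bar> = \<bar>M (fst e) (snd e) - 2 * \<Lambda>\<bar> / 4"
    proof -
      have "\<beta> e = - ((M (fst e) (snd e) - 2 * \<Lambda>) / 4)"
        by (simp add: \<beta>_def field_simps)
      then show ?thesis
        by (simp only: abs_minus_cancel abs_divide abs_numeral)
    qed
    ultimately show ?thesis
      by (simp add: mult.commute)
  qed
  then have "(\<beta> e)\<^sup>2 \<le> (\<Lambda> / (4 * n))\<^sup>2" if "e \<in> set es" for e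
    using power_mono[of "\<bar>\<beta> e\<bar>" "\<Lambda> / (4 * n)" 2] that by simp
  then have "B \<le> (\<Sum>e\<leftarrow>es. (\<Lambda> / (4 * n))\<^sup>2)"
    unfolding B_def by (intro sum_list_mono) auto
  also have "\<dots> = n * (\<Lambda> / (4 * n))\<^sup>2"
    by (simp add: n_def sum_list_triv)
  also have "\<dots> = \<Lambda>\<^sup>2 / (16 * n)"
    using \<open>n \<ge> 1\<close> by (simp add: field_simps power2_eq_square)
  finally have B_le: "B \<le> \<Lambda>\<^sup>2 / (16 * n)" .
  have "B \<ge> 0"
    unfolding B_def by (intro sum_list_nonneg) auto
  let ?J = "sq_subsums (map \<beta> es)"
  \<comment> \<open>The first equation is for subset sums without the entry \<open>z\<close> chosen
    below, the second for those with it, both multiplied by \<open>w\<close>.\<close>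
  define bad where "bad = (\<Union>u\<in>U. \<Union>i\<in>{..length es}. \<Union>j\<in>?J.
    {w. real i * w\<^sup>2 + (u - \<delta>) * w + j = 0} \<union> {w. (real i - n) * w\<^sup>2 + (u + \<Lambda> - \<delta>) * w + (j - B) = 0})"
  have "u - \<delta> \<noteq> 0" "u + \<Lambda> - \<delta> \<noteq> 0" if "u \<in> U" for u
    using that U(2,3) by (auto simp: algebra_simps)
  then have "finite bad"
    unfolding bad_def using U(1) finite_sq_subsums
    by (intro finite_UN_I finite_UnI finite_quadratic_roots finite_atMost)
  \<comment> \<open>The upper end keeps \<open>n * w\<close>, the lower end \<open>B / w\<close>, at
    most \<open>\<Lambda> / 2\<close>, so that \<open>z\<close> below is the root of a nonnegative
    number.\<close>
  have "infinite {\<Lambda> / (4 * n)<..<\<Lambda> / (2 * n)}"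
    using \<Lambda> \<open>n \<ge> 1\<close> by (intro infinite_Ioo) (simp add: field_simps)
  from Diff_infinite_finite[OF \<open>finite bad\<close> this]
  have "{\<Lambda> / (4 * n)<..<\<Lambda> / (2 * n)} - bad \<noteq> {}"
    by (metis finite.emptyI)
  then obtain w where "w \<in> {\<Lambda> / (4 * n)<..<\<Lambda> / (2 * n)} - bad"
    by blast
  then have w: "\<Lambda> / (4 * n) < w" "w < \<Lambda> / (2 * n)" "w \<notin> bad"
    by auto
  have "w > 0"
    using w(1) \<Lambda> \<open>n \<ge> 1\<close> by (smt (verit) divide_pos_pos)
  define y where "y = sqrt w"
  have y: "y\<^sup>2 = w" "y \<noteq> 0"
    using \<open>w > 0\<close> by (auto simp: y_def)
  define z where "z = sqrt (\<Lambda> - n * w - B / w)"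
  have "n * w \<le> \<Lambda> / 2"
    using w(2) \<open>n \<ge> 1\<close> by (simp add: field_simps)
  moreover have "B / w \<le> \<Lambda> / 2"
  proof -
    have "B \<le> \<Lambda> / 4 * (\<Lambda> / (4 * n))"
      using B_le by (simp add: power2_eq_square)
    also have "\<dots> \<le> \<Lambda> / 2 * w"
      using w(1) \<Lambda> \<open>n \<ge> 1\<close> by (intro mult_mono) auto
    finally show ?thesis
      using \<open>w > 0\<close> by (simp add: field_simps)
  qed
  ultimately have "\<Lambda> - n * w - B / w \<ge> 0"
    by linarith
  then have z: "z\<^sup>2 = \<Lambda> - n * w - B / w"
    by (simp add: z_def)
  \<comment> \<open>The filler \<open>[z, 0]\<close> is a pair with zero overlap product: it raises
    all squared distances of distinct points to the common value \<open>2 * \<Lambda>\<close> before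
    correction.\<close>
  define v where "v = pair_block \<beta> es y @ [z, 0]"
  have sum_es: "(\<Sum>e\<leftarrow>es. (\<beta> e / y)\<^sup>2 + y\<^sup>2) = B / w + n * w"
  proof -
    have "(\<beta> e / y)\<^sup>2 = (\<beta> e)\<^sup>2 * inverse w" for e
      by (simp only: power_divide y(1) divide_inverse[of _ w])
    then show ?thesis
      by (simp add: y sum_list_addf B_def n_def sum_list_triv divide_inverse sum_list_mult_const)
  qed
  have sum_\<beta>: "(\<Sum>e\<leftarrow>es. if e = (a, b) \<or> e = (b, a) then \<beta> e else 0) = \<Lambda> - M a b / 2"
    if "a \<in> T" "b \<in> T" "a \<noteq> b" for a b
  proof -
    have "(\<Sum>e\<leftarrow>es. if e = (a, b) \<or> e = (b, a) then \<beta> e else 0) =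
        (\<Sum>e\<in>set es. if e = (a, b) \<or> e = (b, a) then \<beta> e else 0)"
      using es(2) by (simp add: sum_list_distinct_conv_sum_set)
    also have "\<dots> = (\<Sum>e\<in>{(a, b), (b, a)}. \<beta> e)"
      using that by (intro sum.mono_neutral_cong_right finite_set) (auto simp: es(1))
    also have "\<dots> = \<Lambda> - M a b / 2"
      using that sym[OF that(1,2)] by (simp add: \<beta>_def)
    finally show ?thesis .
  qed
  have "realizes T v (\<lambda>a b. (if a = b then 0 else 2 * (\<Sum>e\<leftarrow>es. (\<beta> e / y)\<^sup>2 + y\<^sup>2) -
      2 * (\<Sum>e\<leftarrow>es. if e = (a, b) \<or> e = (b, a) then \<beta> e else 0)) +
      (if a = b then 0 else 2 * (z\<^sup>2 + 0\<^sup>2) - (if (p, q) = (a, b) \<or> (p, q) = (b, a) then 2 * (z * 0) else 0)))"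
    unfolding v_def using es(1) y(2)
    by (intro realizes_append realizes_pair_block realizes_pair fin ne(3)) auto
  then have r: "realizes T v (\<lambda>a b. if a = b then 0 else M a b)"
    by (rule realizes_cong) (simp add: sum_es sum_\<beta> z)
  show ?thesis
  proof (rule that[OF r])
    fix u s
    assume us: "u \<in> U" "s \<in> sq_subsums v"
    then obtain s1 s2 where s: "s1 \<in> sq_subsums (pair_block \<beta> es y)" "s2 \<in> sq_subsums [z, 0]" "s = s1 + s2"
      unfolding v_def using sq_subsums_append by blast
    obtain i j where ij: "i \<le> length es" "j \<in> ?J" "s1 = real i * w + j / w"
      using sq_subsums_pair_block[OF y(2) s(1)] y(1) by auto
    then have ne0: "real i * w\<^sup>2 + (u - \<delta>) * w + j \<noteq> 0"
        "(real i - n) * w\<^sup>2 + (u + \<Lambda> - \<delta>) * w + (j - B) \<noteq> 0"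
      using w(3) us(1) unfolding bad_def by blast+
    show "u + s \<noteq> \<delta>"
    proof
      assume eq: "u + s = \<delta>"
      from s(2) consider "s2 = 0" | "s2 = \<Lambda> - n * w - B / w"
        using z by auto
      then show False
      proof cases
        case 1
        then have "u + (real i * w + j / w) = \<delta>"
          using eq s(3) ij(3) by simp
        then show False
          using ne0(1) \<open>w > 0\<close> by (simp add: field_simps power2_eq_square)
      next
        case 2
        then have "u + (real i * w + j / w) + (\<Lambda> - n * w - B / w) = \<delta>"
          using eq s(3) ij(3) by simp
        moreover have "(real i - n) * w\<^sup>2 + (u + \<Lambda> - \<delta>) * w + (j - B) =
            w * (u + (real i * w + j / w) + (\<Lambda> - n * w - B / w) - \<delta>)"
          using \<open>w > 0\<close> by (simp add: algebra_simps power2_eq_square)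
        ultimately show False
          using ne0(2) by simp
      qed
    qed
  qed
qed


section \<open>Simplices\<close>

theorem theorem1p3:
  fixes d :: nat and S :: config
  assumes "d \<ge> 1" and "is_simplex_config d S"
  shows "P_Ramsey S"
proof -
  have S: "finite S" "\<not> affine_dependent S" "card S \<ge> 2"
    using assms by (auto simp: is_simplex_config_def)
  then obtain p q where pq: "p \<in> S" "q \<in> S" "p \<noteq> q"
    by (metis card_2_iff' ex_card subset_iff)
  define \<delta> where "\<delta> = (dist p q)\<^sup>2 / 2"
  have "\<delta> > 0"
    using pq(3) by (simp add: \<delta>_def)
  obtain w where w: "\<And>a b t. a \<in> S \<Longrightarrow> b \<in> S \<Longrightarrow> a \<noteq> b \<Longrightarrow>
    (dist (a + t *\<^sub>R w a) (b + t *\<^sub>R w b))\<^sup>2 = (dist a b)\<^sup>2 - t + t\<^sup>2 * (dist (w a) (w b))\<^sup>2"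
    using affine_independent_contraction[OF S(1,2)] by blast
  define W where "W = 1 + (\<Sum>a\<in>S. \<Sum>b\<in>S. (dist (w a) (w b))\<^sup>2)"
  have W: "(dist (w a) (w b))\<^sup>2 \<le> W" if "a \<in> S" "b \<in> S" for a b
  proof -
    have "(dist (w a) (w b))\<^sup>2 \<le> (\<Sum>b\<in>S. (dist (w a) (w b))\<^sup>2)"
      using that S(1) by (intro member_le_sum[of b S]) auto
    also have "\<dots> \<le> (\<Sum>a\<in>S. \<Sum>b\<in>S. (dist (w a) (w b))\<^sup>2)"
      using that S(1) by (intro member_le_sum[of a S "\<lambda>a. \<Sum>b\<in>S. (dist (w a) (w b))\<^sup>2"]) (auto simp: sum_nonneg)
    finally show ?thesis
      by (simp add: W_def)
  qed
  have "W > 0"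
    by (simp add: W_def sum_nonneg add_pos_nonneg)
  define n where "n = real ((card S)\<^sup>2)"
  have "n > 0"
    using S(3) by (simp add: n_def)
  \<comment> \<open>The first bound keeps \<open>\<delta> - \<Lambda>\<close> positive, so that it
    can be a forbidden subset sum. The second bounds the quadratic error of the contraction by
    \<open>\<Lambda> / (2 * n)\<close>.\<close>
  define \<Lambda> where "\<Lambda> = min (\<delta> / 2) (1 / (8 * n * W))"
  have \<Lambda>: "0 < \<Lambda>" "\<Lambda> < \<delta>" "\<Lambda> \<le> 1 / (8 * n * W)"
    using \<open>\<delta> > 0\<close> \<open>W > 0\<close> \<open>n > 0\<close> by (auto simp: \<Lambda>_def min_less_iff_disj)
  \<comment> \<open>The contraction with \<open>t = 2 * \<Lambda>\<close> leaves a remainder close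
    to \<open>2 * \<Lambda>\<close> for every pair.\<close>
  define f where "f a = a + (2 * \<Lambda>) *\<^sub>R w a" for a
  define A where "A = (\<Union>a\<in>S. {i. coord (f a) i \<noteq> 0})"
  have A: "finite A"
    unfolding A_def using S(1) finite_support by blast
  have f_coord: "(dist (f a) (f b))\<^sup>2 = (\<Sum>i\<in>A. (coord (f a) i - coord (f b) i)\<^sup>2)" if "a \<in> S" "b \<in> S" for a b
  proof -
    have "dist (f a) (f b) = sqrt (\<Sum>i\<in>A. (coord (f a) i - coord (f b) i)\<^sup>2)"
      using that by (intro dist_rinfty_eq A) (force simp: A_def)
    then show ?thesis
      by (simp add: sum_nonneg)
  qed
  \<comment> \<open>The approximation may use the other half of the tolerance
    \<open>\<Lambda> / n\<close>. The two excluded values are those that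
    \<open>realizes_almost_regular\<close> forbids in \<open>U\<close>, here
    \<open>sq_subsums v\<close>.\<close>
  obtain v D where D: "realizes S v D"
    "\<And>a b. a \<in> S \<Longrightarrow> b \<in> S \<Longrightarrow> \<bar>D a b - (dist (f a) (f b))\<^sup>2\<bar> < \<Lambda> / (2 * n)"
    "sq_subsums v \<inter> {\<delta>, \<delta> - \<Lambda>} = {}"
    using realizes_approx_generic[OF A S(1), of "\<Lambda> / (2 * n)" "{\<delta>, \<delta> - \<Lambda>}" "\<lambda>a. coord (f a)"]
      \<Lambda> \<open>n > 0\<close> f_coord by auto
  define M where "M a b = (dist a b)\<^sup>2 - D a b" for a b
  have sym: "M a b = M b a" if "a \<in> S" "b \<in> S" for a b
    using realizes_sym[OF D(1) that] by (simp add: M_def dist_commute)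
  have close: "\<bar>M a b - 2 * \<Lambda>\<bar> \<le> \<Lambda> / (card S)\<^sup>2" if ab: "a \<in> S" "b \<in> S" "a \<noteq> b" for a b
  proof -
    have "(2 * \<Lambda>)\<^sup>2 * (dist (w a) (w b))\<^sup>2 \<le> (2 * \<Lambda>)\<^sup>2 * W"
      using W[OF ab(1,2)] by (intro mult_left_mono) auto
    also have "\<dots> = 4 * \<Lambda> * (\<Lambda> * W)"
      by (simp add: power2_eq_square)
    also have "\<dots> \<le> 4 * \<Lambda> * (1 / (8 * n))"
      using \<Lambda> \<open>W > 0\<close> \<open>n > 0\<close> by (intro mult_left_mono) (auto simp: field_simps)
    finally have "(2 * \<Lambda>)\<^sup>2 * (dist (w a) (w b))\<^sup>2 \<le> \<Lambda> / (2 * n)"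
      by simp
    moreover have "0 \<le> (2 * \<Lambda>)\<^sup>2 * (dist (w a) (w b))\<^sup>2"
      by simp
    moreover have "(dist (f a) (f b))\<^sup>2 = (dist a b)\<^sup>2 - 2 * \<Lambda> + (2 * \<Lambda>)\<^sup>2 * (dist (w a) (w b))\<^sup>2"
      unfolding f_def by (rule w[OF ab])
    ultimately have "\<bar>M a b - 2 * \<Lambda>\<bar> \<le> \<Lambda> / (2 * n) + \<Lambda> / (2 * n)"
      using D(2)[OF ab(1,2)] unfolding M_def by linarith
    then show ?thesis
      by (simp add: n_def)
  qed
  obtain u where u: "realizes S u (\<lambda>a b. if a = b then 0 else M a b)"
    "\<And>s t. s \<in> sq_subsums v \<Longrightarrow> t \<in> sq_subsums u \<Longrightarrow> s + t \<noteq> \<delta>"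
    using realizes_almost_regular[where M = M and \<delta> = \<delta>, OF S(1) pq sym \<Lambda>(1) close finite_sq_subsums[of v]] D(3)
    by blast
  have "realizes S (v @ u) (\<lambda>a b. (dist a b)\<^sup>2)"
    by (rule realizes_cong[OF realizes_append[OF D(1) u(1)]])
      (auto simp: M_def realizes_self[OF D(1)])
  moreover have "\<delta> \<notin> sq_subsums (v @ u)"
    using u(2) sq_subsums_append by metis
  ultimately show ?thesis
    using P_RamseyI[OF S(1) _ pq(1,2)] by (simp add: \<delta>_def)
qed

end
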